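(* For each positive integer $T$ divisible by $6$, consider the instance with horizon $T$, capacity $B=T/6$ and $k=2$ customer types with $$\lambda_1=\tfrac12,\ v_1=\tfrac14,\ p_1=\tfrac12;\qquad \lambda_2=\tfrac12,\ v_2=\tfrac12-\tfrac1T,\ p_2=1.$$ Then the clairvoyant index policy incurs an expected loss of $\Omega(\sqrt T)$ relative to the clairvoyant general objective: there exist constants $c>0$ and $T_0$ such that for all such $T\ge T_0$, $$\mathbb E_{\vec A}\left[\widehat{\mathrm{OPT}}_{\vec A}-\mathcal H_{\vec A}[1]\right]\ge c\sqrt T.$$
   Context: $\mathbb N=\{0,1,2,\dots\}$. In each period $t=1,\dots,T$ one customer arrives; the types $A_1,\dots,A_T$ are i.i.d. with $\mathbb P[A_t=j]=\lambda_j$, $\vec A=(A_1,\dots,A_T)$, and $N_j$ is the number of type $j$ arrivals in $\vec A$. If $\vec x\in\mathbb N^k$ customers (by type) are accepted in total, the objective is $\sum_jv_jx_j-\mathbb E\big[\big(\sum_jX_{j,x_j}-B\big)^+\big]$, where $X_{j,x_j}\sim\mathrm{Bin}(x_j,p_j)$ are independent. $\widehat{\mathrm{OPT}}_{\vec A}$ (clairvoyant general objective) is the maximum of the objective over $\vec x\in\mathbb N^k$ with $0\le x_j\le N_j$ for all $j$. $\mathcal H_{\vec A}[1]$ (clairvoyant index objective) is the maximum of the objective over those feasible $\vec x$ that are index solutions, i.e. for which there is $\tilde j\in[k]$ with $x_j=N_j$ for all $j<\tilde j$ and $x_j=0$ for all $j>\tilde j$. Types are indexed in decreasing order of $v_j/p_j$,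 as is the case here. *)

theory Defs
  imports "HOL-Probability.Probability"
begin

text \<open>
  Customer types are the numbers \<open>1, \<dots>, k\<close>. The components \<open>arr_prob\<close>, \<open>val\<close> and
  \<open>show_prob\<close> are the parameters \<open>\<lambda>\<^sub>j\<close>, \<open>v\<^sub>j\<close> and \<open>p\<^sub>j\<close>; their values outside \<open>{1..k}\<close> are
  irrelevant.
\<close>

record problem =
  horizon :: nat
  capacity :: nat
  ntypes :: nat
  arr_prob :: "nat \<Rightarrow> real"
  val :: "nat \<Rightarrow> real"
  show_prob :: "nat \<Rightarrow> real"

definition valid_problem :: "problem \<Rightarrow> bool" where
  "valid_problem I \<longleftrightarrow>
     ntypes I \<ge> 1 \<and>
     (\<forall>j\<in>{1..ntypes I}. arr_prob I j \<ge> 0) \<and> (\<Sum>j=1..ntypes I. arr_prob I j) = 1 \<and>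
     (\<forall>j\<in>{1..ntypes I}. 0 < show_prob I j \<and> show_prob I j \<le> 1) \<and>
     (\<forall>i\<in>{1..ntypes I}. \<forall>j\<in>{1..ntypes I}.
        i \<le> j \<longrightarrow> val I j / show_prob I j \<le> val I i / show_prob I i)"

definition type_pmf :: "problem \<Rightarrow> nat pmf" where
  "type_pmf I = embed_pmf (\<lambda>j. if j \<in> {1..ntypes I} then arr_prob I j else 0)"

definition arrivals_pmf :: "problem \<Rightarrow> (nat \<Rightarrow> nat) pmf" where
  "arrivals_pmf I = Pi_pmf {1..horizon I} 0 (\<lambda>_. type_pmf I)"

definition num_arrivals :: "problem \<Rightarrow> (nat \<Rightarrow> nat) \<Rightarrow> nat \<Rightarrow> nat" where
  "num_arrivals I A j = card {t \<in> {1..horizon I}. A t = j}"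

definition objective :: "problem \<Rightarrow> (nat \<Rightarrow> nat) \<Rightarrow> real" where
  "objective I x =
     (\<Sum>j=1..ntypes I. val I j * real (x j)) -
     measure_pmf.expectation
       (Pi_pmf {1..ntypes I} 0 (\<lambda>j. binomial_pmf (x j) (show_prob I j)))
       (\<lambda>X. max 0 (real (\<Sum>j=1..ntypes I. X j) - real (capacity I)))"

definition feasible :: "problem \<Rightarrow> (nat \<Rightarrow> nat) \<Rightarrow> (nat \<Rightarrow> nat) set" where
  "feasible I A = (\<Pi>\<^sub>E j\<in>{1..ntypes I}. {0..num_arrivals I A j})"

definition index_solution :: "problem \<Rightarrow> (nat \<Rightarrow> nat) \<Rightarrow> (nat \<Rightarrow> nat) \<Rightarrow> bool" where
  "index_solution I A x \<longleftrightarrow>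
     (\<exists>i\<in>{1..ntypes I}. \<forall>j\<in>{1..ntypes I}.
        (j < i \<longrightarrow> x j = num_arrivals I A j) \<and> (j > i \<longrightarrow> x j = 0))"

definition clairvoyant_opt :: "problem \<Rightarrow> (nat \<Rightarrow> nat) \<Rightarrow> real" where
  "clairvoyant_opt I A = Max (objective I ` feasible I A)"

definition clairvoyant_index :: "problem \<Rightarrow> (nat \<Rightarrow> nat) \<Rightarrow> real" where
  "clairvoyant_index I A = Max (objective I ` {x \<in> feasible I A. index_solution I A x})"

definition example_problem :: "nat \<Rightarrow> problem" where
  "example_problem T =
     \<lparr> horizon = T,
       capacity = T div 6,
       ntypes = 2,
       arr_prob = (\<lambda>j. 1/2),
       val = (\<lambda>j. if j = 1 then 1/4 else 1/2 - 1 / real T),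
       show_prob = (\<lambda>j. if j = 1 then 1/2 else 1) \<rparr>"

lemma valid_example_problem: "valid_problem (example_problem T)"
proof -
  have "{1..2} = {1, 2::nat}" by auto
  then show ?thesis by (simp add: valid_problem_def example_problem_def)
qed

lemma pmf_type_pmf:
  assumes "valid_problem I"
  shows "pmf (type_pmf I) j = (if j \<in> {1..ntypes I} then arr_prob I j else 0)"
proof -
  let ?f = "\<lambda>j. if j \<in> {1..ntypes I} then arr_prob I j else 0"
  have nonneg: "?f j \<ge> 0" for j
    using assms by (auto simp: valid_problem_def)
  have "(\<integral>\<^sup>+j. ennreal (?f j) \<partial>count_space UNIV) = (\<Sum>j\<in>{1..ntypes I}. ennreal (?f j))"
    by (rule nn_integral_count_space'[of "{1..ntypes I}"]) auto
  also have "\<dots> = ennreal (\<Sum>j\<in>{1..ntypes I}. ?f j)"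
    by (rule sum_ennreal) (rule nonneg)
  also have "(\<Sum>j\<in>{1..ntypes I}. ?f j) = 1"
    using assms by (simp add: valid_problem_def)
  finally show ?thesis
    unfolding type_pmf_def by (subst pmf_embed_pmf) (use nonneg in auto)
qed

lemma finite_feasible: "finite (feasible I A)"
  unfolding feasible_def by (rule finite_PiE) auto

lemma index_solution_exists:
  assumes "valid_problem I"
  shows "{x \<in> feasible I A. index_solution I A x} \<noteq> {}"
proof -
  have "restrict (\<lambda>_. 0) {1..ntypes I} \<in> {x \<in> feasible I A. index_solution I A x}"
    using assms unfolding feasible_def index_solution_def valid_problem_def
    by (auto intro!: bexI[of _ 1])
  then show ?thesis by blast
qed

end

theory Submission
  imports Defs
begin

text \<open>
  Let \<open>S\<close> be the number of accepted customers who show up. Since both types have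
  \<open>v\<^sub>j / p\<^sub>j = 1/2\<close> up to the perturbation \<open>1/T\<close>, the identity
  \<open>s/2 - (s - B)\<^sup>+ = B/2 - \<bar>s - B\<bar>/2\<close> turns the objective into
  \<open>B/2 - E\<bar>S - B\<bar>/2 - x\<^sub>2/T\<close>. Accepting exactly \<open>B\<close> customers of the deterministic type 2 costs
  only \<open>B/T = 1/6\<close>, whereas, when \<open>N\<^sub>1 \<ge> B\<close>, every index solution either misses \<open>B\<close> by a constant
  factor or contains at least \<open>B\<close> random customers, so that \<open>E\<bar>S - B\<bar>\<close> is of order \<open>\<surd>B\<close>.
\<close>

section \<open>Moments and absolute deviations of the fair binomial law\<close>

lemma integrable_binomial_pmf [simp]:
  fixes f :: "nat \<Rightarrow> real"
  assumes "p \<in> {0..1}"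
  shows "integrable (measure_pmf (binomial_pmf n p)) f"
  using assms by (intro integrable_measure_pmf_finite finite_set_pmf_binomial_pmf) auto

lemma binomial_pmf_prob_1: "binomial_pmf n 1 = return_pmf n"
proof (rule pmf_eqI)
  fix k
  show "pmf (binomial_pmf n 1) k = pmf (return_pmf n) k"
    by (cases k n rule: linorder_cases) (simp_all add: power_0_left)
qed

text \<open>Conditioning on one fair coin; this recursion drives the inductions for the reflection
  and all moments below.\<close>

lemma expectation_binomial_half_Suc:
  fixes f :: "nat \<Rightarrow> real"
  shows "measure_pmf.expectation (binomial_pmf (Suc n) (1/2)) f =
    (measure_pmf.expectation (binomial_pmf n (1/2)) (\<lambda>k. f (Suc k)) +
     measure_pmf.expectation (binomial_pmf n (1/2)) f) / 2"
proof -
  have "measure_pmf.expectation (binomial_pmf (Suc n) (1/2)) f =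
    measure_pmf.expectation (bernoulli_pmf (1/2) \<bind>
       (\<lambda>b. map_pmf (\<lambda>k. (if b then 1 else 0) + k) (binomial_pmf n (1/2)))) f"
    by (simp add: binomial_pmf_Suc map_pmf_def)
  also have "\<dots> = (\<Sum>b\<in>UNIV. pmf (bernoulli_pmf (1/2)) b *\<^sub>R
      measure_pmf.expectation (map_pmf (\<lambda>k. (if b then 1 else 0) + k) (binomial_pmf n (1/2))) f)"
    by (rule pmf_expectation_bind) (auto intro: finite_set_pmf_binomial_pmf)
  finally show ?thesis by (simp add: UNIV_bool field_simps)
qed

lemma expectation_binomial_half_reflect:
  fixes f :: "nat \<Rightarrow> real"
  shows "measure_pmf.expectation (binomial_pmf n (1/2)) (\<lambda>k. f (n - k)) =
    measure_pmf.expectation (binomial_pmf n (1/2)) f"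
proof (induction n arbitrary: f)
  case 0
  show ?case by (simp add: binomial_pmf_0)
next
  case (Suc n)
  \<comment> \<open>Truncated subtraction gives \<open>Suc n - k = Suc (n - k)\<close> only for
    \<open>k \<le> n\<close>, hence only on the support.\<close>
  have "measure_pmf.expectation (binomial_pmf n (1/2)) (\<lambda>k. f (Suc n - k)) =
    measure_pmf.expectation (binomial_pmf n (1/2)) (\<lambda>k. f (Suc (n - k)))"
    by (intro integral_cong_AE)
      (auto simp: AE_measure_pmf_iff set_pmf_binomial_eq Suc_diff_le)
  then show ?case
    using Suc.IH[of f] Suc.IH[of "\<lambda>k. f (Suc k)"]
    by (simp add: expectation_binomial_half_Suc)
qed

lemma binomial_half_mean:
  "measure_pmf.expectation (binomial_pmf n (1/2)) real = real n / 2"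
  by (induction n) (simp_all add: binomial_pmf_0 expectation_binomial_half_Suc field_simps)

lemma binomial_half_second_moment:
  "measure_pmf.expectation (binomial_pmf n (1/2)) (\<lambda>k. (real k - real n / 2)^2) = real n / 4"
proof (induction n)
  case 0
  show ?case by (simp add: binomial_pmf_0)
next
  case (Suc n)
  let ?E = "measure_pmf.expectation (binomial_pmf n (1/2))"
  have "measure_pmf.expectation (binomial_pmf (Suc n) (1/2)) (\<lambda>k. (real k - real (Suc n) / 2)^2) =
    ?E (\<lambda>k. ((real (Suc k) - real (Suc n) / 2)^2 + (real k - real (Suc n) / 2)^2) / 2)"
    by (simp add: expectation_binomial_half_Suc)
  also have "\<dots> = ?E (\<lambda>k. (real k - real n / 2)^2 + 1/4)"
    by (intro Bochner_Integration.integral_cong) (auto simp: field_simps power2_eq_square)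
  also have "\<dots> = real (Suc n) / 4"
    by (simp add: Suc.IH)
  finally show ?case .
qed

text \<open>One more coin moves the centred variable by +1/2 or -1/2, so averaging the two expanded
  powers leaves only even powers. Paired with the second moment, this bounds the first absolute
  moment from below.\<close>

lemma binomial_half_fourth_moment:
  "measure_pmf.expectation (binomial_pmf n (1/2)) (\<lambda>k. (real k - real n / 2)^4) =
    3 * (real n)^2 / 16 - real n / 8"
proof (induction n)
  case 0
  show ?case by (simp add: binomial_pmf_0)
next
  case (Suc n)
  let ?E = "measure_pmf.expectation (binomial_pmf n (1/2))"
  have *: "((y + 1/2)^4 + (y - 1/2)^4) / 2 = y^4 + 3/2 * y^2 + 1/16" for y :: real
    by (simp add: power4_eq_xxxx power2_eq_square field_simps)
  have "measure_pmf.expectation (binomial_pmf (Suc n) (1/2)) (\<lambda>k. (real k - real (Suc n) / 2)^4) =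
    ?E (\<lambda>k. ((real (Suc k) - real (Suc n) / 2)^4 + (real k - real (Suc n) / 2)^4) / 2)"
    by (simp add: expectation_binomial_half_Suc)
  also have "\<dots> = ?E (\<lambda>k. (real k - real n / 2)^4 + 3/2 * (real k - real n / 2)^2 + 1/16)"
  proof (intro Bochner_Integration.integral_cong refl)
    fix k
    have "real (Suc k) - real (Suc n) / 2 = (real k - real n / 2) + 1/2"
      "real k - real (Suc n) / 2 = (real k - real n / 2) - 1/2"
      by (simp_all add: field_simps)
    then show "((real (Suc k) - real (Suc n) / 2)^4 + (real k - real (Suc n) / 2)^4) / 2 =
        (real k - real n / 2)^4 + 3/2 * (real k - real n / 2)^2 + 1/16"
      by (simp only: *)
  qed
  also have "\<dots> = (3 * (real n)^2 / 16 - real n / 8) + 3/2 * (real n / 4) + 1/16"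
    by (simp add: Suc.IH binomial_half_second_moment)
  also have "\<dots> = 3 * (real (Suc n))^2 / 16 - real (Suc n) / 8"
    by (simp add: field_simps power2_eq_square)
  finally show ?case .
qed

text \<open>Apply \<open>u^2 - u^4 \<le> u\<close> to the deviation in units of
  \<open>sqrt n\<close>. The leading constants of the two moments leave 1/4 - 3/16 = 1/16, and the
  lower-order term of the fourth moment only helps.\<close>

lemma binomial_half_mean_abs_dev_ge:
  "measure_pmf.expectation (binomial_pmf n (1/2)) (\<lambda>k. \<bar>real k - real n / 2\<bar>) \<ge> sqrt (real n) / 16"
proof (cases "n = 0")
  case False
  let ?E = "measure_pmf.expectation (binomial_pmf n (1/2))"
  define s where "s = sqrt (real n)"
  have s: "s > 0" "real n = s^2" using False by (auto simp: s_def)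
  have cubic: "u^2 - u^4 \<le> u" if "u \<ge> 0" for u :: real
  proof -
    have "u^2 - u^4 \<le> u * (u - u^3)" by (simp add: power2_eq_square power3_eq_cube power4_eq_xxxx algebra_simps)
    also have "u - u^3 \<le> 1"
    proof (cases "u \<le> 1")
      case True
      moreover have "u^3 \<ge> 0" using that by simp
      ultimately show ?thesis by linarith
    next
      case False
      then have "u^1 \<le> u^3" by (intro power_increasing) auto
      then show ?thesis by simp
    qed
    then have "u * (u - u^3) \<le> u" using that by (simp add: mult_left_le)
    finally show ?thesis .
  qed
  have "(real k - real n / 2)^2 / s - (real k - real n / 2)^4 / s^3 \<le> \<bar>real k - real n / 2\<bar>" for k
  proof -
    define y where "y = \<bar>real k - real n / 2\<bar>"
    have "s * ((y/s)^2 - (y/s)^4) \<le> s * (y/s)"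
      using s(1) by (intro mult_left_mono cubic) (auto simp: y_def)
    moreover have "s * ((y/s)^2 - (y/s)^4) = y^2 / s - y^4 / s^3"
      using s(1) by (simp add: field_simps power2_eq_square power3_eq_cube power4_eq_xxxx)
    ultimately have "y^2 / s - y^4 / s^3 \<le> y" using s(1) by simp
    then show ?thesis by (simp add: y_def)
  qed
  then have "?E (\<lambda>k. (real k - real n / 2)^2 / s - (real k - real n / 2)^4 / s^3)
      \<le> ?E (\<lambda>k. \<bar>real k - real n / 2\<bar>)"
    by (intro integral_mono) auto
  also have "?E (\<lambda>k. (real k - real n / 2)^2 / s - (real k - real n / 2)^4 / s^3) =
      real n / 4 / s - (3 * (real n)^2 / 16 - real n / 8) / s^3"
    by (simp add: binomial_half_second_moment binomial_half_fourth_moment)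
  also have "\<dots> = s / 16 + 1 / (8 * s)"
    using s(1) unfolding s(2) by (simp add: field_simps power2_eq_square power3_eq_cube)
  finally have "s / 16 + 1 / (8 * s) \<le> ?E (\<lambda>k. \<bar>real k - real n / 2\<bar>)" .
  moreover have "1 / (8 * s) > 0" using s(1) by simp
  ultimately show ?thesis unfolding s_def by linarith
qed simp

text \<open>By symmetry the mean absolute deviation is smallest around the centre \<open>n/2\<close>.\<close>

lemma binomial_half_abs_dev_ge:
  fixes a :: real
  shows "measure_pmf.expectation (binomial_pmf n (1/2)) (\<lambda>k. \<bar>real k - a\<bar>) \<ge> sqrt (real n) / 16"
proof -
  let ?E = "measure_pmf.expectation (binomial_pmf n (1/2))"
  \<comment> \<open>Triangle inequality: the points \<open>k\<close> and \<open>n - k\<close> are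
    \<open>\<bar>2 * k - n\<bar>\<close> apart, whatever \<open>a\<close> is.\<close>
  have "?E (\<lambda>k. \<bar>real k - real n / 2\<bar>) \<le> ?E (\<lambda>k. (\<bar>real k - a\<bar> + \<bar>real (n - k) - a\<bar>) / 2)"
    by (intro integral_mono_AE)
      (auto simp: AE_measure_pmf_iff set_pmf_binomial_eq of_nat_diff abs_if field_simps)
  also have "\<dots> = (?E (\<lambda>k. \<bar>real k - a\<bar>) + ?E (\<lambda>k. \<bar>real (n - k) - a\<bar>)) / 2"
    by simp
  also have "?E (\<lambda>k. \<bar>real (n - k) - a\<bar>) = ?E (\<lambda>k. \<bar>real k - a\<bar>)"
    by (rule expectation_binomial_half_reflect)
  finally show ?thesis using binomial_half_mean_abs_dev_ge[of n] by simp
qed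

text \<open>Fewer than \<open>b\<close> coins have mean below \<open>b/2\<close>, so the expected
  shortfall alone exceeds \<open>b/2\<close>.\<close>

lemma binomial_half_abs_dev_ge_target:
  assumes "n < b"
  shows "measure_pmf.expectation (binomial_pmf n (1/2)) (\<lambda>k. \<bar>real k - real b\<bar>) \<ge> sqrt (real b) / 16"
proof -
  have "measure_pmf.expectation (binomial_pmf n (1/2)) (\<lambda>k. \<bar>real k - real b\<bar>)
      \<ge> measure_pmf.expectation (binomial_pmf n (1/2)) (\<lambda>k. real b - real k)"
    by (intro integral_mono) auto
  moreover have "measure_pmf.expectation (binomial_pmf n (1/2)) (\<lambda>k. real b - real k) = b - n / 2"
    by (simp add: binomial_half_mean)
  moreover have "sqrt (real b) \<le> real b"
    using assms by (intro real_le_lsqrt) (auto simp: power2_eq_square)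
  ultimately show ?thesis using assms by linarith
qed

section \<open>Arrival counts in the example\<close>

lemma set_type_pmf_example: "set_pmf (type_pmf (example_problem T)) \<subseteq> {1, 2}"
  using pmf_type_pmf[OF valid_example_problem[of T]]
  by (auto simp: set_pmf_eq example_problem_def split: if_splits)

lemma finite_set_arrivals_example: "finite (set_pmf (arrivals_pmf (example_problem T)))"
proof -
  have "finite (set_pmf (type_pmf (example_problem T)))"
    by (rule finite_subset[OF set_type_pmf_example]) simp
  then show ?thesis
    unfolding arrivals_pmf_def by (subst set_Pi_pmf) (auto intro!: finite_PiE_dflt)
qed

lemma num_arrivals_example_sum:
  assumes "A \<in> set_pmf (arrivals_pmf (example_problem T))"
  shows "num_arrivals (example_problem T) A 1 + num_arrivals (example_problem T) A 2 = T"
proof -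
  have A: "A t \<in> {1, 2}" if "t \<in> {1..T}" for t
    using assms that set_type_pmf_example[of T]
    by (auto simp: arrivals_pmf_def set_Pi_pmf PiE_dflt_def example_problem_def)
  have "card {t \<in> {1..T}. A t = 1} + card {t \<in> {1..T}. A t = 2} =
      card ({t \<in> {1..T}. A t = 1} \<union> {t \<in> {1..T}. A t = 2})"
    by (subst card_Un_disjoint) auto
  also have "{t \<in> {1..T}. A t = 1} \<union> {t \<in> {1..T}. A t = 2} = {1..T}"
    using A by blast
  finally show ?thesis by (simp add: num_arrivals_def example_problem_def)
qed

text \<open>The events "arrival \<open>t\<close> has type 1" are independent fair coins, so the
  binomial moments also apply to the arrivals.\<close>

lemma map_num_arrivals_example:
  "map_pmf (\<lambda>A. num_arrivals (example_problem T) A 1) (arrivals_pmf (example_problem T)) =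
    binomial_pmf T (1/2)"
proof -
  let ?I = "example_problem T"
  have "pmf (map_pmf (\<lambda>j. j = 1) (type_pmf ?I)) True = pmf (type_pmf ?I) 1"
    by (simp add: pmf_map vimage_def pmf.rep_eq)
  also have "\<dots> = 1/2"
    by (simp add: pmf_type_pmf[OF valid_example_problem]) (simp add: example_problem_def)
  finally have T: "pmf (map_pmf (\<lambda>j. j = 1) (type_pmf ?I)) True = 1/2" .
  have bern: "map_pmf (\<lambda>j. j = 1) (type_pmf ?I) = bernoulli_pmf (1/2)"
  proof (rule pmf_eqI)
    fix b
    show "pmf (map_pmf (\<lambda>j. j = 1) (type_pmf ?I)) b = pmf (bernoulli_pmf (1/2)) b"
      using T pmf_False_conv_True[of "map_pmf (\<lambda>j. j = 1) (type_pmf ?I)"] by (cases b) auto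
  qed
  have "binomial_pmf T (1/2) = map_pmf (\<lambda>f. card {t \<in> {1..T}. f t})
      (Pi_pmf {1..T} False (\<lambda>_. map_pmf (\<lambda>j. j = 1) (type_pmf ?I)))"
    unfolding bern by (rule binomial_pmf_altdef') auto
  also have "\<dots> = map_pmf (\<lambda>f. card {t \<in> {1..T}. f t})
      (map_pmf (\<lambda>h. (\<lambda>j. j = 1) \<circ> h) (Pi_pmf {1..T} 0 (\<lambda>_. type_pmf ?I)))"
    by (subst Pi_pmf_map[where dflt = 0]) auto
  finally show ?thesis
    by (simp add: map_pmf_comp arrivals_pmf_def num_arrivals_def example_problem_def)
qed

section \<open>Objective values in the example\<close>

lemma objective_example:
  assumes "T = 6 * b" "b > 0"
  shows "objective (example_problem T) x = real b / 2 - real (x 2) / T -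
    measure_pmf.expectation (binomial_pmf (x 1) (1/2)) (\<lambda>k. \<bar>real k + real (x 2) - real b\<bar>) / 2"
proof -
  let ?I = "example_problem T" and ?E = "measure_pmf.expectation (binomial_pmf (x 1) (1/2))"
  have types: "{1..ntypes ?I} = {1, 2}" by (auto simp: example_problem_def)
  \<comment> \<open>Type 2 always shows up, so its factor is a point mass and only the type 1 count
    stays random.\<close>
  have joint: "Pi_pmf {1, 2} 0 (\<lambda>j. binomial_pmf (x j) (show_prob ?I j)) =
    map_pmf (\<lambda>k. (\<lambda>_. 0)(2 := x 2, 1 := k)) (binomial_pmf (x 1) (1/2))"
    by (simp add: Pi_pmf_insert Pi_pmf_singleton example_problem_def binomial_pmf_prob_1
        pair_return_pmf2 map_pmf_comp fun_upd_def)
  have "objective ?I x = real (x 1) / 4 + (1/2 - 1/T) * real (x 2) -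
      ?E (\<lambda>k. max 0 (real k + real (x 2) - real b))"
    unfolding objective_def types joint using assms by (simp add: example_problem_def)
  also have "?E (\<lambda>k. max 0 (real k + real (x 2) - real b)) =
      ?E (\<lambda>k. (\<bar>real k + real (x 2) - real b\<bar> + (real k + (real (x 2) - real b))) / 2)"
    by (intro Bochner_Integration.integral_cong) (auto simp: max_def abs_if)
  also have "\<dots> = (?E (\<lambda>k. \<bar>real k + real (x 2) - real b\<bar>) + (real (x 1) / 2 + (real (x 2) - real b))) / 2"
    by (simp add: binomial_half_mean)
  finally show ?thesis by (simp add: algebra_simps add_divide_distrib diff_divide_distrib)
qed

lemma index_objective_example_le:
  assumes "T = 6 * b" "b > 0"
    and "index_solution (example_problem T) A x" "num_arrivals (example_problem T) A 1 \<ge> b"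
  shows "objective (example_problem T) x \<le> real b / 2 - sqrt (real b) / 32"
proof -
  let ?E = "measure_pmf.expectation (binomial_pmf (x 1) (1/2)) (\<lambda>k. \<bar>real k + real (x 2) - real b\<bar>)"
  have "?E \<ge> sqrt (real b) / 16"
  proof (cases "x 1 \<ge> b")
    case True
    then have "sqrt (real b) / 16 \<le> sqrt (real (x 1)) / 16" by simp
    also have "\<dots> \<le> ?E"
      using binomial_half_abs_dev_ge[of "x 1" "real b - real (x 2)"] by (simp add: algebra_simps)
    finally show ?thesis .
  next
    case False
    obtain i where i: "i \<in> {1..2}" "\<forall>j\<in>{1..2}. (j < i \<longrightarrow> x j = num_arrivals (example_problem T) A j)
        \<and> (j > i \<longrightarrow> x j = 0)"
      using assms(3) by (auto simp: index_solution_def example_problem_def)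
    \<comment> \<open>Threshold 2 would accept all type 1 arrivals, of which there are at least
      \<open>b\<close>.\<close>
    have "i = 1" using i False assms(4) by (cases "i = 1") auto
    then have "x 2 = 0" using i by auto
    then show ?thesis using binomial_half_abs_dev_ge_target[of "x 1" b] False by simp
  qed
  moreover have "real (x 2) / real T \<ge> 0" by simp
  ultimately show ?thesis unfolding objective_example[OF assms(1,2)] by linarith
qed

section \<open>Loss along each arrival sequence, then in expectation\<close>

lemma clairvoyant_index_le_opt:
  assumes "valid_problem I"
  shows "clairvoyant_index I A \<le> clairvoyant_opt I A"
  unfolding clairvoyant_index_def clairvoyant_opt_def
  using index_solution_exists[OF assms, of A] finite_feasible[of I A]
  by (intro Max_mono) auto

lemma clairvoyant_loss_example_ge:
  assumes "T = 6 * b" "b > 0"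
    and "num_arrivals (example_problem T) A 1 \<ge> b" "num_arrivals (example_problem T) A 2 \<ge> b"
  shows "clairvoyant_opt (example_problem T) A - clairvoyant_index (example_problem T) A
    \<ge> sqrt (real b) / 32 - 1/6"
proof -
  let ?I = "example_problem T"
  have "clairvoyant_index ?I A \<le> real b / 2 - sqrt (real b) / 32"
    unfolding clairvoyant_index_def
    using index_solution_exists[OF valid_example_problem, of T A] finite_feasible[of ?I A]
      index_objective_example_le[OF assms(1,2) _ assms(3)]
    by (subst Max_le_iff) auto
  moreover have "clairvoyant_opt ?I A \<ge> real b / 2 - 1/6"
  proof -
    \<comment> \<open>Filling the capacity with type 2 alone makes the deviation vanish; only the
      perturbation \<open>b / T = 1/6\<close> is lost.\<close>
    define x where "x = (\<lambda>j\<in>{1..2::nat}. if j = 1 then 0 else b)"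
    have "x \<in> feasible ?I A"
    proof -
      have "{1..ntypes ?I} = {1, 2}" "{1..2} = {1, 2::nat}" by (auto simp: example_problem_def)
      then show ?thesis using assms(4) by (auto simp: feasible_def x_def)
    qed
    then have "objective ?I x \<le> clairvoyant_opt ?I A"
      unfolding clairvoyant_opt_def using finite_feasible[of ?I A] by (intro Max_ge) auto
    moreover have "objective ?I x = real b / 2 - 1/6"
      unfolding objective_example[OF assms(1,2)]
      using assms(1,2) by (simp add: x_def binomial_pmf_0)
    ultimately show ?thesis by simp
  qed
  ultimately show ?thesis by linarith
qed

text \<open>
  The quadratic factor is Chebyshev's inequality in disguise: it is nonpositive unless both types
  have at least \<open>b\<close> arrivals.
\<close>

lemma clairvoyant_loss_example_ge_quadratic:
  assumes T: "T = 6 * b" "b > 0"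
    and "A \<in> set_pmf (arrivals_pmf (example_problem T))"
    and L: "sqrt (real b) / 32 - 1/6 \<ge> 0"
  shows "(sqrt (real b) / 32 - 1/6) *
      (1 - 9 / (real T)^2 * (real (num_arrivals (example_problem T) A 1) - real T / 2)^2)
    \<le> clairvoyant_opt (example_problem T) A - clairvoyant_index (example_problem T) A"
proof -
  define n where "n = num_arrivals (example_problem T) A 1"
  define L where "L = sqrt (real b) / 32 - 1/6"
  \<comment> \<open>Since \<open>T = 6 * b\<close>, the factor \<open>9 / T^2\<close> is
    \<open>1 / (2 * b)^2\<close>, where \<open>2 * b\<close> is the distance from the mean
    \<open>3 * b\<close> to \<open>b\<close> and to \<open>5 * b\<close>.\<close>
  define q where "q = 9 / (real T)^2 * (real n - real T / 2)^2"
  have n2: "n + num_arrivals (example_problem T) A 2 = T"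
    using num_arrivals_example_sum[OF assms(3)] by (simp add: n_def)
  have "L * (1 - q) \<le> clairvoyant_opt (example_problem T) A - clairvoyant_index (example_problem T) A"
  proof (cases "n \<ge> b \<and> num_arrivals (example_problem T) A 2 \<ge> b")
    case True
    have "q \<ge> 0" by (simp add: q_def)
    then have "L * (1 - q) \<le> L" using L by (simp add: mult_left_le L_def)
    also have "L \<le> clairvoyant_opt (example_problem T) A - clairvoyant_index (example_problem T) A"
      using clairvoyant_loss_example_ge[OF T, of A] True by (simp add: L_def n_def)
    finally show ?thesis .
  next
    case False
    then have "real n \<le> b \<or> real n \<ge> 5 * b" using n2 T by auto
    then have "2 * real b \<le> \<bar>real n - real T / 2\<bar>" using T by auto
    then have "(2 * real b)^2 \<le> (real n - real T / 2)^2"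
      by (metis abs_le_square_iff abs_of_nonneg of_nat_0_le_iff mult_nonneg_nonneg zero_le_numeral)
    moreover have "q = (real n - real T / 2)^2 / (2 * real b)^2"
      using T(2) by (simp add: q_def T(1) power_mult_distrib)
    ultimately have "q \<ge> 1" using T(2) by (simp add: le_divide_eq)
    then have "L * (1 - q) \<le> 0" using L by (intro mult_nonneg_nonpos) (auto simp: L_def)
    then show ?thesis
      \<comment> \<open>On atypical arrival sequences the loss is merely known to be nonnegative,
        which suffices here.\<close>
      using clairvoyant_index_le_opt[OF valid_example_problem, of T A] by linarith
  qed
  then show ?thesis by (simp add: L_def q_def n_def)
qed

theorem mainTheorem7:
  "\<exists>c::real. c > 0 \<and>
     (\<exists>T0::nat. \<forall>T::nat. T \<ge> T0 \<and> T > 0 \<and> 6 dvd T \<longrightarrow>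
        measure_pmf.expectation (arrivals_pmf (example_problem T))
          (\<lambda>A. clairvoyant_opt (example_problem T) A - clairvoyant_index (example_problem T) A)
        \<ge> c * sqrt (real T))"
\<comment> \<open>384 = 64 * 2 * 3: 64 from absorbing the 1/6 into \<open>sqrt b / 32\<close>, 2
  from the Chebyshev factor, 3 from \<open>sqrt 6 \<le> 3\<close>. The threshold 1000 gives
  \<open>sqrt b \<ge> 11\<close>, enough for the absorption.\<close>
proof (intro exI[of _ "1/384"] conjI exI[of _ 1000] allI impI)
  fix T :: nat
  assume "T \<ge> 1000 \<and> T > 0 \<and> 6 dvd T"
  then obtain b where T: "T = 6 * b" "T \<ge> 1000" by auto
  let ?I = "example_problem T"
  let ?E = "measure_pmf.expectation (arrivals_pmf ?I)"
  define L where "L = sqrt (real b) / 32 - 1/6"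
  have b: "b > 0" "real b \<ge> 121" using T by auto
  have "sqrt (real b) \<ge> 11" using b by (intro real_le_rsqrt) auto
  then have L: "L \<ge> sqrt (real b) / 64" "L \<ge> 0" unfolding L_def by linarith+
  have int: "integrable (measure_pmf (arrivals_pmf ?I)) f" for f :: "(nat \<Rightarrow> nat) \<Rightarrow> real"
    by (rule integrable_measure_pmf_finite[OF finite_set_arrivals_example])
  have var: "?E (\<lambda>A. (real (num_arrivals ?I A 1) - real T / 2)^2) = real T / 4"
    using binomial_half_second_moment[of T]
    unfolding map_num_arrivals_example[symmetric] integral_map_pmf .
  have "sqrt (real T) = sqrt 6 * sqrt (real b)" using T by (simp add: real_sqrt_mult)
  also have "\<dots> \<le> 3 * sqrt (real b)" by (intro mult_right_mono real_le_lsqrt) auto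
  finally have "1/384 * sqrt (real T) \<le> L * (1/2)" using L(1) by simp
  \<comment> \<open>The variance \<open>T / 4\<close> makes the subtracted term
    \<open>9 / (4 * T)\<close>, below 1/2 for such \<open>T\<close>.\<close>
  also have "\<dots> \<le> L * (1 - 9 / (real T)^2 * (real T / 4))"
    using T(2) L(2) by (intro mult_left_mono) (auto simp: power2_eq_square field_simps)
  also have "\<dots> = ?E (\<lambda>A. L * (1 - 9 / (real T)^2 * (real (num_arrivals ?I A 1) - real T / 2)^2))"
    by (simp only: integral_mult_right_zero Bochner_Integration.integral_diff[OF int int] var
        measure_pmf.prob_space lebesgue_integral_const) simp
  also have "\<dots> \<le> ?E (\<lambda>A. clairvoyant_opt ?I A - clairvoyant_index ?I A)"
    using clairvoyant_loss_example_ge_quadratic[OF T(1) b(1)] L(2)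
    by (intro integral_mono_AE int) (auto simp: AE_measure_pmf_iff L_def)
  finally show "1/384 * sqrt (real T) \<le> ?E (\<lambda>A. clairvoyant_opt ?I A - clairvoyant_index ?I A)" .
qed simp

end
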